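(* Let $m,n,p,q$ be integers with $0\le m\le q$, $0\le n\le p$, let $a_i,b_j\in\mathbb{C}$ and $\alpha_i,\beta_j>0$ ($1\le i\le p$, $1\le j\le q$), and let $\mathcal H(s)=\mathcal{H}^{m,n}_{p,q}(s)$, $\Delta$, $\delta$, $\mu$ and the contours $\mathfrak L_{-\infty}$, $\mathfrak L_{+\infty}$ be as defined in the context. Then the $H$-function $$H^{m,n}_{p,q}(z)=\frac1{2\pi i}\int_{\mathfrak L}\mathcal H(s)\,z^{-s}\,ds$$ exists (that is, the integral converges) in each of the following cases: 1. $\mathfrak L=\mathfrak L_{-\infty}$, $\Delta>0$, $z\ne0$; 2. $\mathfrak L=\mathfrak L_{-\infty}$, $\Delta=0$, $0<|z|<\delta$; 3. $\mathfrak L=\mathfrak L_{-\infty}$, $\Delta=0$, $|z|=\delta$, $\operatorname{Re}(\mu)<-1$; 4. $\mathfrak L=\mathfrak L_{+\infty}$, $\Delta<0$, $z\ne0$; 5. $\mathfrak L=\mathfrak L_{+\infty}$, $\Delta=0$, $|z|>\delta$; 6. $\mathfrak L=\mathfrak L_{+\infty}$, $\Delta=0$, $|z|=\delta$, $\operatorname{Re}(\mu)<-1$.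
   Context: Definitions (empty products equal $1$, and $1/\Gamma$ is entire): $$\mathcal H(s)=\mathcal H^{m,n}_{p,q}(s)=\frac{\prod_{j=1}^m\Gamma(b_j+\beta_js)\ \prod_{i=1}^n\Gamma(1-a_i-\alpha_is)}{\prod_{i=n+1}^p\Gamma(a_i+\alpha_is)\ \prod_{j=m+1}^q\Gamma(1-b_j-\beta_js)},$$ $$\Delta=\sum_{j=1}^q\beta_j-\sum_{i=1}^p\alpha_i,\qquad \delta=\prod_{i=1}^p\alpha_i^{-\alpha_i}\prod_{j=1}^q\beta_j^{\beta_j},\qquad \mu=\sum_{j=1}^qb_j-\sum_{i=1}^pa_i+\frac{p-q}2 .$$ $\mathfrak L_{-\infty}$ denotes a loop running from $-\infty+i\varphi_1$ to $-\infty+i\varphi_2$ with $\varphi_1<\varphi_2$ (for $\operatorname{Re}s$ sufficiently negative it consists of the horizontal half-lines $\operatorname{Im}s=\varphi_1$ and $\operatorname{Im}s=\varphi_2$), passing through no pole, such that all poles of $\Gamma(b_j+\beta_js)$ ($j=1,\dots,m$) lie to the left of it (inside the loop) and all poles of $\Gamma(1-a_i-\alpha_is)$ ($i=1,\dots,n$) lie to the right of it (outside the loop). $\mathfrak L_{+\infty}$ denotes a loop running from $+\infty+i\varphi_1$ to $+\infty+i\varphi_2$ with $\varphi_1<\varphi_2$ (for $\operatorname{Re}s$ sufficiently large it consists of the half-lines $\operatorname{Im}s=\varphi_1$, $\operatorname{Im}s=\varphi_2$), passing through no pole, such that all poles of $\Gamma(b_j+\beta_js)$ ($j=1,\dots,m$)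 lie to the left of it (outside the loop) and all poles of $\Gamma(1-a_i-\alpha_is)$ ($i=1,\dots,n$) lie to the right of it (inside the loop). It is understood that the parameters admit such a contour. Here $z^{-s}=\exp(-s\log z)$ with any chosen value $\log z=\log|z|+i\arg z$. *)

theory Defs
  imports "HOL-Complex_Analysis.Complex_Analysis"
begin

(* Parameters a_i, alpha_i (1 <= i <= p) and b_j, beta_j (1 <= j <= q) are functions on nat
   whose values outside these ranges are never used. *)

definition H_kernel ::
  "nat \<Rightarrow> nat \<Rightarrow> nat \<Rightarrow> nat \<Rightarrow> (nat \<Rightarrow> complex) \<Rightarrow> (nat \<Rightarrow> real) \<Rightarrow> (nat \<Rightarrow> complex) \<Rightarrow> (nat \<Rightarrow> real)
    \<Rightarrow> complex \<Rightarrow> complex" where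
  "H_kernel m n p q a \<alpha> b \<beta> s =
     (\<Prod>j=1..m. Gamma (b j + of_real (\<beta> j) * s)) *
     (\<Prod>i=1..n. Gamma (1 - a i - of_real (\<alpha> i) * s)) *
     (\<Prod>i=n+1..p. rGamma (a i + of_real (\<alpha> i) * s)) *
     (\<Prod>j=m+1..q. rGamma (1 - b j - of_real (\<beta> j) * s))"

definition H_Delta :: "nat \<Rightarrow> nat \<Rightarrow> (nat \<Rightarrow> real) \<Rightarrow> (nat \<Rightarrow> real) \<Rightarrow> real" where
  "H_Delta p q \<alpha> \<beta> = (\<Sum>j=1..q. \<beta> j) - (\<Sum>i=1..p. \<alpha> i)"

definition H_delta :: "nat \<Rightarrow> nat \<Rightarrow> (nat \<Rightarrow> real) \<Rightarrow> (nat \<Rightarrow> real) \<Rightarrow> real" where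
  "H_delta p q \<alpha> \<beta> = (\<Prod>i=1..p. \<alpha> i powr (- \<alpha> i)) * (\<Prod>j=1..q. \<beta> j powr \<beta> j)"

definition H_mu :: "nat \<Rightarrow> nat \<Rightarrow> (nat \<Rightarrow> complex) \<Rightarrow> (nat \<Rightarrow> complex) \<Rightarrow> complex" where
  "H_mu p q a b = (\<Sum>j=1..q. b j) - (\<Sum>i=1..p. a i) + (of_nat p - of_nat q) / 2"

(* An infinite loop is a simple piecewise C1 curve parametrised by the whole real line.
   With \<sigma> = -1 it runs from -oo + i \<phi>1 to -oo + i \<phi>2, with \<sigma> = 1 from +oo + i \<phi>1 to +oo + i \<phi>2.
   Parametrising the two half-lines by arc length, with real part \<sigma> \<bar>t\<bar>, loses no generality:
   T may be taken large and the part between the half-lines reparametrised. *)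

definition infinite_loop :: "real \<Rightarrow> real \<Rightarrow> real \<Rightarrow> (real \<Rightarrow> complex) \<Rightarrow> bool" where
  "infinite_loop \<sigma> \<phi>1 \<phi>2 \<gamma> \<longleftrightarrow>
     \<phi>1 < \<phi>2 \<and> inj \<gamma> \<and>
     (\<exists>T>0. \<gamma> piecewise_C1_differentiable_on {-T..T} \<and>
        (\<forall>t\<le>-T. \<gamma> t = Complex (\<sigma> * \<bar>t\<bar>) \<phi>1) \<and>
        (\<forall>t\<ge>T. \<gamma> t = Complex (\<sigma> * \<bar>t\<bar>) \<phi>2))"

(* The complement of the loop has two connected components; the inside is the one that
   contains the far end of the strip between the two half-lines. The library's inside does
   not apply, because this component is unbounded. *)

definition loop_inside :: "real \<Rightarrow> real \<Rightarrow> real \<Rightarrow> (real \<Rightarrow> complex) \<Rightarrow> complex set" where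
  "loop_inside \<sigma> \<phi>1 \<phi>2 \<gamma> =
     {s. \<exists>R. \<forall>w. \<phi>1 < Im w \<and> Im w < \<phi>2 \<and> \<sigma> * Re w \<ge> R \<longrightarrow>
           connected_component (- range \<gamma>) s w}"

definition loop_outside :: "real \<Rightarrow> real \<Rightarrow> real \<Rightarrow> (real \<Rightarrow> complex) \<Rightarrow> complex set" where
  "loop_outside \<sigma> \<phi>1 \<phi>2 \<gamma> = - range \<gamma> - loop_inside \<sigma> \<phi>1 \<phi>2 \<gamma>"

(* Neither the inside nor the outside meets the loop, so in the next two definitions
   the loop passes through no pole. *)

definition H_loop_minus_infinity ::
  "nat \<Rightarrow> nat \<Rightarrow> (nat \<Rightarrow> complex) \<Rightarrow> (nat \<Rightarrow> real) \<Rightarrow> (nat \<Rightarrow> complex) \<Rightarrow> (nat \<Rightarrow> real)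
    \<Rightarrow> (real \<Rightarrow> complex) \<Rightarrow> bool" where
  "H_loop_minus_infinity m n a \<alpha> b \<beta> \<gamma> \<longleftrightarrow>
     (\<exists>\<phi>1 \<phi>2. infinite_loop (-1) \<phi>1 \<phi>2 \<gamma> \<and>
        (\<forall>j\<in>{1..m}. \<forall>s. is_pole (\<lambda>s. Gamma (b j + of_real (\<beta> j) * s)) s
           \<longrightarrow> s \<in> loop_inside (-1) \<phi>1 \<phi>2 \<gamma>) \<and>
        (\<forall>i\<in>{1..n}. \<forall>s. is_pole (\<lambda>s. Gamma (1 - a i - of_real (\<alpha> i) * s)) s
           \<longrightarrow> s \<in> loop_outside (-1) \<phi>1 \<phi>2 \<gamma>))"

definition H_loop_plus_infinity ::
  "nat \<Rightarrow> nat \<Rightarrow> (nat \<Rightarrow> complex) \<Rightarrow> (nat \<Rightarrow> real) \<Rightarrow> (nat \<Rightarrow> complex) \<Rightarrow> (nat \<Rightarrow> real)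
    \<Rightarrow> (real \<Rightarrow> complex) \<Rightarrow> bool" where
  "H_loop_plus_infinity m n a \<alpha> b \<beta> \<gamma> \<longleftrightarrow>
     (\<exists>\<phi>1 \<phi>2. infinite_loop 1 \<phi>1 \<phi>2 \<gamma> \<and>
        (\<forall>j\<in>{1..m}. \<forall>s. is_pole (\<lambda>s. Gamma (b j + of_real (\<beta> j) * s)) s
           \<longrightarrow> s \<in> loop_outside 1 \<phi>1 \<phi>2 \<gamma>) \<and>
        (\<forall>i\<in>{1..n}. \<forall>s. is_pole (\<lambda>s. Gamma (1 - a i - of_real (\<alpha> i) * s)) s
           \<longrightarrow> s \<in> loop_inside 1 \<phi>1 \<phi>2 \<gamma>))"

(* The Henstock-Kurzweil integral over the whole line includes the improper integral: by
   Hake's theorem it exists iff the integrals over [-R, S] converge as R, S tend to infinity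
   independently. *)

definition has_loop_integral :: "(complex \<Rightarrow> complex) \<Rightarrow> complex \<Rightarrow> (real \<Rightarrow> complex) \<Rightarrow> bool" where
  "has_loop_integral f I \<gamma> \<longleftrightarrow>
     ((\<lambda>t. f (\<gamma> t) * vector_derivative \<gamma> (at t)) has_integral I) UNIV"

(* h is the value at z of the H-function with contour \<gamma>; the argument logz is the chosen
   value of log z, so that z^{-s} = exp (-s logz). *)

definition has_H_function ::
  "nat \<Rightarrow> nat \<Rightarrow> nat \<Rightarrow> nat \<Rightarrow> (nat \<Rightarrow> complex) \<Rightarrow> (nat \<Rightarrow> real) \<Rightarrow> (nat \<Rightarrow> complex) \<Rightarrow> (nat \<Rightarrow> real)
    \<Rightarrow> (real \<Rightarrow> complex) \<Rightarrow> complex \<Rightarrow> complex \<Rightarrow> bool" where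
  "has_H_function m n p q a \<alpha> b \<beta> \<gamma> logz h \<longleftrightarrow>
     (\<exists>I. has_loop_integral (\<lambda>s. H_kernel m n p q a \<alpha> b \<beta> s * exp (- s * logz)) I \<gamma> \<and>
          h = 1 / (2 * of_real pi * \<i>) * I)"

end

theory Submission
  imports Defs "HOL-Real_Asymp.Real_Asymp"
begin

text \<open>
  On a horizontal ray \<open>s = -t + i\<phi>\<close> the reflection formula turns every factor of the kernel into a
  Gamma function, or the reciprocal of one, whose argument has real part tending to \<open>+\<infinity>\<close>; the sines
  that appear are bounded, and bounded away from zero where they occur in a denominator, because no
  pole lies on the ray. Stirling's bound then shows that the integrand is
  \<open>O(t powr (Re \<mu>) * exp (- \<Delta> t ln t + (\<Delta> - ln \<delta> + ln |z|) t))\<close>, which is \<open>O(t powr \<kappa>)\<close> for some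
  \<open>\<kappa> < -1\<close> in each case. Stirling's bound itself holds because the logarithm of the quotient of
  \<open>|\<Gamma>(x + c)|\<close> and its main term changes by \<open>O(1/x\<^sup>2)\<close> from \<open>x\<close> to \<open>x + 1\<close>.
  The rays to \<open>+\<infinity>\<close> reduce to those to \<open>-\<infinity>\<close> by the substitution \<open>s \<mapsto> -s\<close>, which exchanges the roles of
  \<open>(a, \<alpha>)\<close> and \<open>(b, \<beta>)\<close>.
\<close>

subsection \<open>Stirling bounds for the complex Gamma function\<close>

text \<open>Every x >= X is u + n with u in the compact interval [X, X + 1] and n a natural number.
  The increments from u to x add at most K times a convergent series of inverse squares, since X >=
  1 gives u + k >= k + 1.\<close>

lemma bounded_if_increments_quadratically_small:
  fixes v :: "real \<Rightarrow> real"
  assumes cont: "continuous_on {X..X + 1} v" and "X \<ge> 1"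
    and incr: "\<And>x. x \<ge> X \<Longrightarrow> \<bar>v (x + 1) - v x\<bar> \<le> K / x\<^sup>2"
  shows "\<exists>B. \<forall>x\<ge>X. \<bar>v x\<bar> \<le> B"
proof -
  obtain M where M: "\<forall>x\<in>{X..X + 1}. \<bar>v x\<bar> \<le> M"
    using compact_imp_bounded[OF compact_continuous_image[OF cont compact_Icc]]
    by (auto simp: bounded_iff)
  have sm: "summable (\<lambda>k. 1 / (real (Suc k))\<^sup>2)"
    using inverse_squares_sums by (simp add: sums_iff add.commute)
  have K: "K \<ge> 0"
    using order_trans[OF abs_ge_zero incr[OF order_refl]] \<open>X \<ge> 1\<close>
    by (simp add: zero_le_divide_iff)
  have step: "\<bar>v (u + real n)\<bar> \<le> M + K * (\<Sum>k<n. 1 / (real (Suc k))\<^sup>2)"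
    if u: "u \<in> {X..X + 1}" for u n
  proof (induction n)
    case 0
    then show ?case using M u by simp
  next
    case (Suc n)
    have "\<bar>v (u + real n + 1) - v (u + real n)\<bar> \<le> K / (u + real n)\<^sup>2"
      using u by (intro incr) auto
    also have "\<dots> \<le> K / (real (Suc n))\<^sup>2"
      using u K \<open>X \<ge> 1\<close> by (intro divide_left_mono power_mono mult_pos_pos) auto
    finally show ?case
      using Suc.IH by (simp add: algebra_simps abs_le_iff)
  qed
  have "\<bar>v x\<bar> \<le> M + K * (\<Sum>k. 1 / (real (Suc k))\<^sup>2)" if x: "x \<ge> X" for x
  proof -
    define n where "n = nat \<lfloor>x - X\<rfloor>"
    have n: "real n \<le> x - X" "x - X < real n + 1"
      using x by (auto simp: n_def)
    have "\<bar>v x\<bar> \<le> M + K * (\<Sum>k<n. 1 / (real (Suc k))\<^sup>2)"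
      using step[of "x - real n" n] n by simp
    also have "\<dots> \<le> M + K * (\<Sum>k. 1 / (real (Suc k))\<^sup>2)"
      using K by (intro add_left_mono mult_left_mono sum_le_suminf sm) auto
    finally show ?thesis .
  qed
  then show ?thesis by blast
qed

lemma Re_pos_imp_not_nonpos_Ints: "Re z > 0 \<Longrightarrow> z \<notin> \<int>\<^sub>\<le>\<^sub>0"
  by (auto elim!: nonpos_Ints_cases)

text \<open>The functional equation \<open>Gamma (w + 1) = w * Gamma w\<close> makes the increment
  of \<open>v\<close> the elementary function \<open>e\<close>, whose expansion involves no Gamma
  function. \<open>X + Re c > 0\<close> keeps the arguments away from the poles.\<close>

lemma norm_Gamma_stirling:
  fixes c :: complex
  shows "\<exists>X B. X \<ge> 1 \<and> X + Re c > 0 \<and>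
    (\<forall>x\<ge>X. \<bar>ln (norm (Gamma (of_real x + c))) - ((x + Re c - 1/2) * ln x - x)\<bar> \<le> B)"
proof -
  define v where
    "v = (\<lambda>x. ln (norm (Gamma (of_real x + c))) - ((x + Re c - 1/2) * ln x - x))"
  define e where "e = (\<lambda>x. ln ((x + Re c)\<^sup>2 + (Im c)\<^sup>2) / 2
    - (x + Re c + 1/2) * ln (x + 1) + (x + Re c - 1/2) * ln x + 1)"
  \<comment> \<open>The term \<open>Re c / x\<close> is subtracted and added back because half the
    logarithm is \<open>Re c / x + O(1/x^2)\<close> and
    \<open>(x + Re c + 1/2) * ln (1 + 1/x)\<close> is \<open>1 + Re c / x + O(1/x^2)\<close>; each
    bracket is then small by itself.\<close>
  have "(\<lambda>x. (ln (1 + 2 * Re c / x + ((Re c)\<^sup>2 + (Im c)\<^sup>2) / x\<^sup>2) / 2 - Re c / x)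
      + (1 - (x + Re c + 1/2) * ln (1 + 1 / x) + Re c / x)) \<in> O(\<lambda>x. 1 / x\<^sup>2)"
    by (rule sum_in_bigo(1)) real_asymp+
  moreover have "eventually (\<lambda>x. (ln (1 + 2 * Re c / x + ((Re c)\<^sup>2 + (Im c)\<^sup>2) / x\<^sup>2) / 2 - Re c / x)
      + (1 - (x + Re c + 1/2) * ln (1 + 1 / x) + Re c / x) = e x) at_top"
    using eventually_gt_at_top[of "\<bar>Re c\<bar>"]
  proof eventually_elim
    case (elim x)
    have pos: "(x + Re c)\<^sup>2 + (Im c)\<^sup>2 > 0" "x > 0"
      using elim by (auto intro: add_pos_nonneg)
    have "1 + 2 * Re c / x + ((Re c)\<^sup>2 + (Im c)\<^sup>2) / x\<^sup>2 = ((x + Re c)\<^sup>2 + (Im c)\<^sup>2) / x\<^sup>2"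
      using pos by (simp add: field_simps power2_eq_square)
    then have 1: "ln (1 + 2 * Re c / x + ((Re c)\<^sup>2 + (Im c)\<^sup>2) / x\<^sup>2)
        = ln ((x + Re c)\<^sup>2 + (Im c)\<^sup>2) - 2 * ln x"
      using pos by (simp add: ln_divide_pos ln_realpow)
    have "1 + 1 / x = (x + 1) / x"
      using pos by (simp add: field_simps)
    then have 2: "ln (1 + 1 / x) = ln (x + 1) - ln x"
      using pos by (simp add: ln_divide_pos)
    show ?case
      unfolding e_def 1 2 by (simp add: algebra_simps diff_divide_distrib)
  qed
  ultimately have "e \<in> O(\<lambda>x. 1 / x\<^sup>2)"
    by (subst (asm) landau_o.big.in_cong) auto
  then obtain K where "eventually (\<lambda>x. norm (e x) \<le> K * norm (1 / x\<^sup>2)) at_top"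
    by (auto elim: landau_o.bigE)
  then obtain X0 where X0: "\<And>x. x \<ge> X0 \<Longrightarrow> \<bar>e x\<bar> \<le> K / x\<^sup>2"
    by (auto simp: eventually_at_top_linorder)
  \<comment> \<open>The value \<open>1 + \<bar>Re c\<bar>\<close> secures both
    \<open>X \<ge> 1\<close> and \<open>X + Re c > 0\<close>.\<close>
  define X where "X = max X0 (1 + \<bar>Re c\<bar>)"
  have X: "X \<ge> X0" "X \<ge> 1" "X + Re c > 0" by (auto simp: X_def)
  have nonpos: "of_real x + c \<notin> \<int>\<^sub>\<le>\<^sub>0" if "x \<ge> X" for x
    using X that by (intro Re_pos_imp_not_nonpos_Ints) auto
  have incr: "v (x + 1) - v x = e x" if x: "x \<ge> X" for x
  proof -
    have "Gamma (of_real (x + 1) + c) = (of_real x + c) * Gamma (of_real x + c)"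
      using Gamma_plus1[OF nonpos[OF x]] by (simp add: add_ac)
    moreover have "Gamma (of_real x + c) \<noteq> 0"
      using nonpos[OF x] by (simp add: Gamma_eq_zero_iff)
    moreover have "of_real x + c \<noteq> 0" using nonpos[OF x] by auto
    moreover have "ln (norm (of_real x + c)) = ln ((x + Re c)\<^sup>2 + (Im c)\<^sup>2) / 2"
      using X x by (subst cmod_def) (simp add: ln_sqrt add_pos_nonneg)
    ultimately have "ln (norm (Gamma (of_real (x + 1) + c)))
        = ln ((x + Re c)\<^sup>2 + (Im c)\<^sup>2) / 2 + ln (norm (Gamma (of_real x + c)))"
      by (simp add: norm_mult ln_mult del: of_real_add)
    then show ?thesis
      unfolding v_def e_def by (simp add: algebra_simps del: of_real_add)
  qed
  have contG: "continuous_on ((\<lambda>x. of_real x + c) ` {X..X + 1}) Gamma"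
    using nonpos by (intro continuous_on_Gamma) auto
  have "continuous_on {X..X + 1} v"
    unfolding v_def using X nonpos
    by (intro continuous_intros continuous_on_compose2[OF contG] order_refl) (auto simp: Gamma_eq_zero_iff)
  then obtain B where "\<forall>x\<ge>X. \<bar>v x\<bar> \<le> B"
    using bounded_if_increments_quadratically_small[of X v K] X X0 incr by force
  then show ?thesis using X unfolding v_def by blast
qed

text \<open>\<open>ln |\<Gamma>(\<alpha> t + c)|\<close> with \<open>Re c = r\<close>, up to a bounded error as \<open>t\<close> tends to infinity.\<close>

definition stirling_exponent :: "real \<Rightarrow> real \<Rightarrow> real \<Rightarrow> real" where
  "stirling_exponent \<alpha> r t = (\<alpha> * t + r - 1/2) * ln t + (\<alpha> * ln \<alpha> - \<alpha>) * t"

text \<open>Stirling's bound at \<open>x = \<alpha> * t\<close>. Since it bounds the logarithm on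
  both sides, it controls Gamma and its reciprocal alike.\<close>

lemma norm_Gamma_bigo:
  fixes c :: complex
  assumes "\<alpha> > 0"
  shows "(\<lambda>t. norm (Gamma (of_real (\<alpha> * t) + c))) \<in> O(\<lambda>t. exp (stirling_exponent \<alpha> (Re c) t))"
    and "(\<lambda>t. norm (rGamma (of_real (\<alpha> * t) + c))) \<in> O(\<lambda>t. exp (- stirling_exponent \<alpha> (Re c) t))"
proof -
  obtain X B where X: "X \<ge> 1" "X + Re c > 0"
    and B: "\<And>x. x \<ge> X \<Longrightarrow>
      \<bar>ln (norm (Gamma (of_real x + c))) - ((x + Re c - 1/2) * ln x - x)\<bar> \<le> B"
    using norm_Gamma_stirling[of c] by blast
  \<comment> \<open>The extra constant comes from
    \<open>ln (\<alpha> * t) = ln \<alpha> + ln t\<close>, multiplied by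
    \<open>Re c - 1/2\<close>.\<close>
  define B' where "B' = B + \<bar>Re c - 1/2\<bar> * \<bar>ln \<alpha>\<bar>"
  have main: "Gamma (of_real (\<alpha> * t) + c) \<noteq> 0 \<and>
      \<bar>ln (norm (Gamma (of_real (\<alpha> * t) + c))) - stirling_exponent \<alpha> (Re c) t\<bar> \<le> B'"
    if t: "t \<ge> X / \<alpha>" for t
  proof
    have at: "\<alpha> * t \<ge> X" using t assms by (simp add: field_simps)
    then have "t > 0" using X assms
      by (metis less_le_trans zero_less_mult_pos zero_less_one)
    show "Gamma (of_real (\<alpha> * t) + c) \<noteq> 0"
      using X at by (subst Gamma_eq_zero_iff) (auto intro!: Re_pos_imp_not_nonpos_Ints)
    have "(\<alpha> * t + Re c - 1/2) * ln (\<alpha> * t) - \<alpha> * t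
        = stirling_exponent \<alpha> (Re c) t + (Re c - 1/2) * ln \<alpha>"
      using \<open>t > 0\<close> assms by (simp add: stirling_exponent_def ln_mult algebra_simps)
    then show "\<bar>ln (norm (Gamma (of_real (\<alpha> * t) + c))) - stirling_exponent \<alpha> (Re c) t\<bar> \<le> B'"
      using B[OF at] unfolding B'_def abs_mult[symmetric] by linarith
  qed
  have ev: "eventually (\<lambda>t. t \<ge> X / \<alpha>) at_top" by (rule eventually_ge_at_top)
  show "(\<lambda>t. norm (Gamma (of_real (\<alpha> * t) + c))) \<in> O(\<lambda>t. exp (stirling_exponent \<alpha> (Re c) t))"
  proof (rule landau_o.bigI[of "exp B'"])
    show "eventually (\<lambda>t. norm (norm (Gamma (of_real (\<alpha> * t) + c)))
        \<le> exp B' * norm (exp (stirling_exponent \<alpha> (Re c) t))) at_top"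
      using ev
    proof eventually_elim
      case (elim t)
      have "exp (ln (norm (Gamma (of_real (\<alpha> * t) + c)))) \<le> exp (B' + stirling_exponent \<alpha> (Re c) t)"
        using main[OF elim] by (subst exp_le_cancel_iff) linarith
      then show ?case using main[OF elim] by (simp add: exp_add)
    qed
  qed auto
  show "(\<lambda>t. norm (rGamma (of_real (\<alpha> * t) + c))) \<in> O(\<lambda>t. exp (- stirling_exponent \<alpha> (Re c) t))"
  proof (rule landau_o.bigI[of "exp B'"])
    show "eventually (\<lambda>t. norm (norm (rGamma (of_real (\<alpha> * t) + c)))
        \<le> exp B' * norm (exp (- stirling_exponent \<alpha> (Re c) t))) at_top"
      using ev
    proof eventually_elim
      case (elim t)
      have "exp (- ln (norm (Gamma (of_real (\<alpha> * t) + c)))) \<le> exp (B' - stirling_exponent \<alpha> (Re c) t)"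
        using main[OF elim] by (subst exp_le_cancel_iff) linarith
      then show ?case using main[OF elim]
        by (simp add: exp_diff exp_minus rGamma_inverse_Gamma norm_divide divide_simps mult_ac)
    qed
  qed auto
qed

section \<open>Reflection of Gamma factors whose argument runs to the left\<close>

text \<open>Expanding the squared norm leaves \<open>cos (2 * Re z)\<close> as the only dependence
  on \<open>Re z\<close>, and this is at most 1. The resulting bound is uniform along a horizontal
  line.\<close>

lemma norm_sin_ge_sinh: "norm (sin z) \<ge> \<bar>sinh (Im z)\<bar>"
proof -
  define E where "E = exp (Im z)"
  have E: "exp (2 * Im z) = E\<^sup>2" "E > 0" by (simp_all add: E_def exp_double)
  have "\<bar>sinh (Im z)\<bar>\<^sup>2 = (E\<^sup>2 + inverse (E\<^sup>2) - 2) / 4"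
    using E(2) by (simp add: sinh_def exp_minus power2_eq_square field_simps flip: E_def)
  also have "\<dots> \<le> (norm (sin z))\<^sup>2"
    unfolding norm_sin_squared E using cos_le_one[of "2 * Re z"] by simp
  finally have "\<bar>sinh (Im z)\<bar>\<^sup>2 \<le> (norm (sin z))\<^sup>2" .
  then show ?thesis by (rule power2_le_imp_le) auto
qed

text \<open>Reflection gives Gamma(w) = pi / (sin(pi w) Gamma(1 - w)). On the ray
  \<open>Im w\<close> is the constant \<open>Im b + \<beta> * \<phi>\<close>, so \<open>nz\<close>
  keeps the sine away from 0, while the real part of 1 - w grows like
  \<open>\<beta> * t\<close>.\<close>

lemma norm_Gamma_reflected_bigo:
  fixes b :: complex
  assumes "\<beta> > 0" and nz: "Im b + \<beta> * \<phi> \<noteq> 0"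
  shows "(\<lambda>t. norm (Gamma (b + of_real \<beta> * Complex (- t) \<phi>)))
    \<in> O(\<lambda>t. exp (- stirling_exponent \<beta> (1 - Re b) t))"
proof -
  define C where "C = pi / \<bar>sinh (pi * (Im b + \<beta> * \<phi>))\<bar>"
  have "(\<lambda>t. norm (Gamma (b + of_real \<beta> * Complex (- t) \<phi>)))
      \<in> O(\<lambda>t. norm (rGamma (of_real (\<beta> * t) + (1 - b - of_real \<beta> * Complex 0 \<phi>))))"
  \<comment> \<open>Adding 1 turns the evident \<open>C \<ge> 0\<close> into the positive constant
    that the rule asks for.\<close>
  proof (rule landau_o.bigI[of "C + 1"])
    show "C + 1 > 0" unfolding C_def by (intro add_nonneg_pos) auto
    show "eventually (\<lambda>t. norm (norm (Gamma (b + of_real \<beta> * Complex (- t) \<phi>)))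
      \<le> (C + 1) * norm (norm (rGamma (of_real (\<beta> * t) + (1 - b - of_real \<beta> * Complex 0 \<phi>))))) at_top"
    proof (intro always_eventually allI)
      fix t
      define w where "w = b + of_real \<beta> * Complex (- t) \<phi>"
      have 1: "of_real (\<beta> * t) + (1 - b - of_real \<beta> * Complex 0 \<phi>) = 1 - w"
        by (simp add: w_def complex_eq_iff)
      have "\<bar>sinh (pi * (Im b + \<beta> * \<phi>))\<bar> \<le> norm (sin (of_real pi * w))"
        using norm_sin_ge_sinh[of "of_real pi * w"] by (simp add: w_def)
      moreover have s: "\<bar>sinh (pi * (Im b + \<beta> * \<phi>))\<bar> > 0" using nz by simp
      ultimately have sp: "norm (sin (of_real pi * w)) > 0" by linarith
      have "rGamma w * rGamma (1 - w) = sin (of_real pi * w) / of_real pi"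
        by (rule rGamma_reflection_complex)
      moreover from this have "rGamma w \<noteq> 0" using sp by auto
      ultimately have "Gamma w = of_real pi / sin (of_real pi * w) * rGamma (1 - w)"
        using sp by (simp add: Gamma_def field_simps)
      then have "norm (Gamma w) = pi / norm (sin (of_real pi * w)) * norm (rGamma (1 - w))"
        by (simp add: norm_mult norm_divide)
      also have "\<dots> \<le> C * norm (rGamma (1 - w))"
        unfolding C_def using s sp \<open>_ \<le> norm (sin (of_real pi * w))\<close>
        by (intro mult_right_mono divide_left_mono mult_pos_pos) auto
      also have "\<dots> \<le> (C + 1) * norm (rGamma (1 - w))"
        by (intro mult_right_mono) auto
      finally show "norm (norm (Gamma (b + of_real \<beta> * Complex (- t) \<phi>)))
        \<le> (C + 1) * norm (norm (rGamma (of_real (\<beta> * t) + (1 - b - of_real \<beta> * Complex 0 \<phi>))))"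
        unfolding 1 by (simp add: w_def)
    qed
  qed
  also have "(\<lambda>t. norm (rGamma (of_real (\<beta> * t) + (1 - b - of_real \<beta> * Complex 0 \<phi>))))
     \<in> O(\<lambda>t. exp (- stirling_exponent \<beta> (1 - Re b) t))"
    using norm_Gamma_bigo(2)[OF assms(1), of "1 - b - of_real \<beta> * Complex 0 \<phi>"] by simp
  finally show ?thesis .
qed

text \<open>In the reflected form the sine now stands in the numerator, where the exponential of its
  constant absolute imaginary part bounds it.\<close>

lemma norm_rGamma_reflected_bigo:
  fixes a :: complex
  assumes "\<alpha> > 0"
  shows "(\<lambda>t. norm (rGamma (a + of_real \<alpha> * Complex (- t) \<phi>)))
    \<in> O(\<lambda>t. exp (stirling_exponent \<alpha> (1 - Re a) t))"
proof -
  have "(\<lambda>t. norm (rGamma (a + of_real \<alpha> * Complex (- t) \<phi>)))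
      \<in> O(\<lambda>t. norm (Gamma (of_real (\<alpha> * t) + (1 - a - of_real \<alpha> * Complex 0 \<phi>))))"
  proof (rule landau_o.bigI[of "exp \<bar>pi * (Im a + \<alpha> * \<phi>)\<bar> / pi"])
    \<comment> \<open>Beyond this threshold \<open>Re (1 - w) > 0\<close>, so
      \<open>rGamma (1 - w)\<close> can be inverted.\<close>
    have "eventually (\<lambda>t. t > - (1 - Re a) / \<alpha>) at_top" by (rule eventually_gt_at_top)
    then show "eventually (\<lambda>t. norm (norm (rGamma (a + of_real \<alpha> * Complex (- t) \<phi>)))
      \<le> exp \<bar>pi * (Im a + \<alpha> * \<phi>)\<bar> / pi
        * norm (norm (Gamma (of_real (\<alpha> * t) + (1 - a - of_real \<alpha> * Complex 0 \<phi>))))) at_top"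
    proof eventually_elim
      case (elim t)
      define w where "w = a + of_real \<alpha> * Complex (- t) \<phi>"
      have 1: "of_real (\<alpha> * t) + (1 - a - of_real \<alpha> * Complex 0 \<phi>) = 1 - w"
        by (simp add: w_def complex_eq_iff)
      have "Re (1 - w) > 0"
        using elim assms by (simp add: w_def field_simps)
      then have "rGamma (1 - w) \<noteq> 0"
        unfolding rGamma_eq_zero_iff by (rule Re_pos_imp_not_nonpos_Ints)
      moreover have "rGamma w * rGamma (1 - w) = sin (of_real pi * w) / of_real pi"
        by (rule rGamma_reflection_complex)
      ultimately have "rGamma w = sin (of_real pi * w) / of_real pi * Gamma (1 - w)"
        by (simp add: Gamma_def field_simps)
      then have "norm (rGamma w) = norm (sin (of_real pi * w)) / pi * norm (Gamma (1 - w))"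
        by (simp add: norm_mult norm_divide)
      also have "\<dots> \<le> exp \<bar>pi * (Im a + \<alpha> * \<phi>)\<bar> / pi * norm (Gamma (1 - w))"
        using cmod_sin_le_exp[of 1 "of_real pi * w"]
        by (intro mult_right_mono divide_right_mono) (auto simp: w_def)
      finally show ?case unfolding 1 by (simp add: w_def)
    qed
  qed auto
  also have "(\<lambda>t. norm (Gamma (of_real (\<alpha> * t) + (1 - a - of_real \<alpha> * Complex 0 \<phi>))))
     \<in> O(\<lambda>t. exp (stirling_exponent \<alpha> (1 - Re a) t))"
    using norm_Gamma_bigo(1)[OF assms(1), of "1 - a - of_real \<alpha> * Complex 0 \<phi>"] by simp
  finally show ?thesis .
qed

subsection \<open>The kernel on horizontal rays\<close>

text \<open>Each factor is matched by b + \<beta> s = 1 - (1 - b) - \<beta> (-s) and its analogue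
  for a. This turns rays to the right into rays to the left.\<close>

lemma H_kernel_swap:
  "H_kernel m n p q a \<alpha> b \<beta> s = H_kernel n m q p (\<lambda>j. 1 - b j) \<beta> (\<lambda>i. 1 - a i) \<alpha> (- s)"
  unfolding H_kernel_def by (simp add: mult_ac)

lemma H_Delta_swap: "H_Delta q p \<beta> \<alpha> = - H_Delta p q \<alpha> \<beta>"
  by (simp add: H_Delta_def)

text \<open>The ones contribute p - q, which turns (q - p)/2 into (p - q)/2; the boundary condition
  on \<mu> is thus the same for both directions.\<close>

lemma H_mu_swap: "H_mu q p (\<lambda>j. 1 - b j) (\<lambda>i. 1 - a i) = H_mu p q a b"
  by (simp add: H_mu_def sum_subtractf field_simps)

text \<open>In logarithmic form \<delta> collects the linear terms
  \<open>\<alpha> * ln \<alpha>\<close> of the Stirling exponents.\<close>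

lemma
  assumes "\<And>i. i \<in> {1..p} \<Longrightarrow> \<alpha> i > 0" and "\<And>j. j \<in> {1..q} \<Longrightarrow> \<beta> j > 0"
  shows H_delta_pos: "H_delta p q \<alpha> \<beta> > 0"
    and ln_H_delta: "ln (H_delta p q \<alpha> \<beta>) = (\<Sum>j=1..q. \<beta> j * ln (\<beta> j)) - (\<Sum>i=1..p. \<alpha> i * ln (\<alpha> i))"
proof -
  have nz: "\<And>i. i \<in> {1..p} \<Longrightarrow> \<alpha> i \<noteq> 0" "\<And>j. j \<in> {1..q} \<Longrightarrow> \<beta> j \<noteq> 0"
    using assms by (metis less_irrefl)+
  have pos: "(\<Prod>i=1..p. \<alpha> i powr - \<alpha> i) > 0" "(\<Prod>j=1..q. \<beta> j powr \<beta> j) > 0"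
    using nz by (auto intro!: prod_pos)
  then show "H_delta p q \<alpha> \<beta> > 0" by (simp add: H_delta_def)
  have "ln (\<Prod>i=1..p. \<alpha> i powr - \<alpha> i) = - (\<Sum>i=1..p. \<alpha> i * ln (\<alpha> i))"
    using nz(1) by (subst ln_prod) (auto simp: sum_negf[symmetric] intro!: sum.cong)
  moreover have "ln (\<Prod>j=1..q. \<beta> j powr \<beta> j) = (\<Sum>j=1..q. \<beta> j * ln (\<beta> j))"
    using nz(2) by (subst ln_prod) (auto intro!: sum.cong)
  ultimately show "ln (H_delta p q \<alpha> \<beta>) = (\<Sum>j=1..q. \<beta> j * ln (\<beta> j)) - (\<Sum>i=1..p. \<alpha> i * ln (\<alpha> i))"
    unfolding H_delta_def using ln_mult_pos[OF pos] by linarith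
qed

text \<open>The parameter \<open>1 - r i\<close> is the one that reflection produces; each summand
  then contributes 1/2 to the factor of \<open>ln t\<close>, the source of (p - q)/2 in \<mu>. For
  infinite \<open>I\<close> all sums and \<open>card I\<close> are 0.\<close>

lemma sum_stirling_exponent:
  "(\<Sum>i\<in>I. stirling_exponent (\<alpha> i) (1 - r i) t)
    = (sum \<alpha> I * t + real (card I) / 2 - sum r I) * ln t + ((\<Sum>i\<in>I. \<alpha> i * ln (\<alpha> i)) - sum \<alpha> I) * t"
  by (induction I rule: infinite_finite_induct)
     (simp_all add: stirling_exponent_def algebra_simps add_divide_distrib)

text \<open>Every factor with \<alpha> contributes a positive Stirling exponent and every factor
  with \<beta> a negative one, whether it stands in the numerator or the denominator. The bound
  therefore does not depend on m and n.\<close>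

lemma norm_H_kernel_bigo:
  assumes "m \<le> q" and "n \<le> p"
    and \<alpha>: "\<And>i. i \<in> {1..p} \<Longrightarrow> \<alpha> i > 0" and \<beta>: "\<And>j. j \<in> {1..q} \<Longrightarrow> \<beta> j > 0"
    and nz: "\<And>j. j \<in> {1..m} \<Longrightarrow> Im (b j) + \<beta> j * \<phi> \<noteq> 0"
  shows "(\<lambda>t. norm (H_kernel m n p q a \<alpha> b \<beta> (Complex (- t) \<phi>)))
    \<in> O(\<lambda>t. exp ((Re (H_mu p q a b) - H_Delta p q \<alpha> \<beta> * t) * ln t
        + (H_Delta p q \<alpha> \<beta> - ln (H_delta p q \<alpha> \<beta>)) * t))"
proof -
  let ?A = "\<lambda>t i. stirling_exponent (\<alpha> i) (1 - Re (a i)) t"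
  let ?B = "\<lambda>t j. stirling_exponent (\<beta> j) (1 - Re (b j)) t"
  \<comment> \<open>These arguments already have real part tending to infinity, so no reflection is
    applied to their factors.\<close>
  have shift: "1 - c - of_real r * Complex (- t) \<phi>
      = of_real (r * t) + (1 - c - of_real r * Complex 0 \<phi>)" for c r t
    by (simp add: complex_eq_iff)
  have split: "(\<Sum>i=1..p. f i) = (\<Sum>i=1..n. f i) + (\<Sum>i=n+1..p. f i)" if "n \<le> p" for n p and f :: "nat \<Rightarrow> real"
    using sum.ub_add_nat[of 1 n f "p - n"] that by simp
  have "(\<lambda>t. norm (H_kernel m n p q a \<alpha> b \<beta> (Complex (- t) \<phi>))) \<in> O(\<lambda>t.
      (\<Prod>j=1..m. exp (- ?B t j)) * (\<Prod>i=1..n. exp (?A t i)) *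
      (\<Prod>i=n+1..p. exp (?A t i)) * (\<Prod>j=m+1..q. exp (- ?B t j)))"
    unfolding H_kernel_def norm_mult prod_norm[symmetric]
  proof (intro landau_o.big.mult landau_o.big_prod)
    fix j assume "j \<in> {1..m}"
    then show "(\<lambda>t. norm (Gamma (b j + of_real (\<beta> j) * Complex (- t) \<phi>))) \<in> O(\<lambda>t. exp (- ?B t j))"
      using assms by (intro norm_Gamma_reflected_bigo) auto
  next
    fix i assume "i \<in> {1..n}"
    then show "(\<lambda>t. norm (Gamma (1 - a i - of_real (\<alpha> i) * Complex (- t) \<phi>))) \<in> O(\<lambda>t. exp (?A t i))"
      using norm_Gamma_bigo(1)[of "\<alpha> i" "1 - a i - of_real (\<alpha> i) * Complex 0 \<phi>"] assms
      unfolding shift by simp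
  next
    fix i assume "i \<in> {n+1..p}"
    then show "(\<lambda>t. norm (rGamma (a i + of_real (\<alpha> i) * Complex (- t) \<phi>))) \<in> O(\<lambda>t. exp (?A t i))"
      using assms by (intro norm_rGamma_reflected_bigo) auto
  next
    fix j assume "j \<in> {m+1..q}"
    then show "(\<lambda>t. norm (rGamma (1 - b j - of_real (\<beta> j) * Complex (- t) \<phi>))) \<in> O(\<lambda>t. exp (- ?B t j))"
      using norm_Gamma_bigo(2)[of "\<beta> j" "1 - b j - of_real (\<beta> j) * Complex 0 \<phi>"] assms
      unfolding shift by simp
  qed
  also have "(\<lambda>t. (\<Prod>j=1..m. exp (- ?B t j)) * (\<Prod>i=1..n. exp (?A t i)) *
      (\<Prod>i=n+1..p. exp (?A t i)) * (\<Prod>j=m+1..q. exp (- ?B t j)))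
      = (\<lambda>t. exp ((\<Sum>i=1..p. ?A t i) - (\<Sum>j=1..q. ?B t j)))"
    unfolding split[OF \<open>m \<le> q\<close>] split[OF \<open>n \<le> p\<close>]
    by (simp only: diff_conv_add_uminus sum_negf[symmetric] minus_add_distrib exp_add exp_sum
        finite_atLeastAtMost mult_ac)
  \<comment> \<open>Collecting coefficients: \<open>ln t\<close> receives
    \<open>Re \<mu> - \<Delta> * t\<close>, and \<open>t\<close> receives
    \<open>\<Delta> - ln \<delta>\<close>.\<close>
  also have "\<dots> = (\<lambda>t. exp ((Re (H_mu p q a b) - H_Delta p q \<alpha> \<beta> * t) * ln t
        + (H_Delta p q \<alpha> \<beta> - ln (H_delta p q \<alpha> \<beta>)) * t))"
  proof
    fix t
    have A: "(\<Sum>i=1..p. ?A t i) = ((\<Sum>i=1..p. \<alpha> i) * t + real p / 2 - (\<Sum>i=1..p. Re (a i))) * ln t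
        + ((\<Sum>i=1..p. \<alpha> i * ln (\<alpha> i)) - (\<Sum>i=1..p. \<alpha> i)) * t"
      by (simp add: sum_stirling_exponent)
    have B: "(\<Sum>j=1..q. ?B t j) = ((\<Sum>j=1..q. \<beta> j) * t + real q / 2 - (\<Sum>j=1..q. Re (b j))) * ln t
        + ((\<Sum>j=1..q. \<beta> j * ln (\<beta> j)) - (\<Sum>j=1..q. \<beta> j)) * t"
      by (simp add: sum_stirling_exponent)
    have lnd: "ln (H_delta p q \<alpha> \<beta>) = (\<Sum>j=1..q. \<beta> j * ln (\<beta> j)) - (\<Sum>i=1..p. \<alpha> i * ln (\<alpha> i))"
      using \<alpha> \<beta> by (rule ln_H_delta)
    have mu: "Re (H_mu p q a b) = (\<Sum>j=1..q. Re (b j)) - (\<Sum>i=1..p. Re (a i)) + (real p - real q) / 2"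
      by (simp add: H_mu_def)
    show "exp ((\<Sum>i=1..p. ?A t i) - (\<Sum>j=1..q. ?B t j))
      = exp ((Re (H_mu p q a b) - H_Delta p q \<alpha> \<beta> * t) * ln t
        + (H_Delta p q \<alpha> \<beta> - ln (H_delta p q \<alpha> \<beta>)) * t)"
      unfolding A B mu H_Delta_def lnd by (simp add: field_simps)
  qed
  finally show ?thesis .
qed

section \<open>Integrable decay of the integrand\<close>

text \<open>Here M, D, d and L stand for \<open>Re \<mu>\<close>, \<Delta>,
  \<open>ln \<delta>\<close> and \<open>ln |z|\<close>. In turn the decay comes from
  \<open>- D * t * ln t\<close>, from the exponential with rate \<open>d - L\<close>, and from the
  power \<open>t powr M\<close> alone. The exponent -2 is an arbitrary choice below -1.\<close>

lemma exp_tail_bigo_powr: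
  fixes M D d L :: real
  assumes "D > 0 \<or> D = 0 \<and> L < d \<or> D = 0 \<and> L = d \<and> M < -1"
  shows "\<exists>\<kappa>. \<kappa> < -1 \<and>
    (\<lambda>t. exp ((M - D * t) * ln t + (D - d) * t) * exp (L * t)) \<in> O(\<lambda>t. t powr \<kappa>)"
  using assms
proof (elim disjE conjE)
  assume "D > 0"
  then have "(\<lambda>t. exp ((M - D * t) * ln t + (D - d + L) * t)) \<in> O(\<lambda>t. t powr (-2))"
    by real_asymp
  then show ?thesis
    by (intro exI[of _ "-2"]) (auto simp: algebra_simps simp flip: exp_add)
next
  assume "D = 0" "L < d"
  define e where "e = d - L"
  have "e > 0" using \<open>L < d\<close> by (simp add: e_def)
  then have "(\<lambda>t. exp (M * ln t - e * t)) \<in> O(\<lambda>t. t powr (-2))"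
    by real_asymp
  then show ?thesis using \<open>D = 0\<close>
    by (intro exI[of _ "-2"]) (auto simp: e_def algebra_simps simp flip: exp_add)
next
  assume "D = 0" "L = d" "M < -1"
  have "(\<lambda>t. exp (M * ln t)) \<in> O(\<lambda>t. t powr M)"
    by real_asymp
  then show ?thesis using \<open>D = 0\<close> \<open>L = d\<close> \<open>M < -1\<close>
    by (intro exI[of _ M]) (auto simp: algebra_simps simp flip: exp_add)
qed

text \<open>One \<open>\<kappa>\<close> is chosen before \<open>\<phi>\<close>, so that it serves
  both half-lines of a loop.\<close>

lemma H_integrand_bigo_powr:
  assumes "m \<le> q" and "n \<le> p"
    and \<alpha>: "\<And>i. i \<in> {1..p} \<Longrightarrow> \<alpha> i > 0" and \<beta>: "\<And>j. j \<in> {1..q} \<Longrightarrow> \<beta> j > 0"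
    and decay: "H_Delta p q \<alpha> \<beta> > 0 \<or>
      H_Delta p q \<alpha> \<beta> = 0 \<and> Re logz < ln (H_delta p q \<alpha> \<beta>) \<or>
      H_Delta p q \<alpha> \<beta> = 0 \<and> Re logz = ln (H_delta p q \<alpha> \<beta>) \<and> Re (H_mu p q a b) < -1"
  shows "\<exists>\<kappa>. \<kappa> < -1 \<and> (\<forall>\<phi>. (\<forall>j\<in>{1..m}. Im (b j) + \<beta> j * \<phi> \<noteq> 0) \<longrightarrow>
    (\<lambda>t. norm (H_kernel m n p q a \<alpha> b \<beta> (Complex (- t) \<phi>) * exp (- Complex (- t) \<phi> * logz)))
      \<in> O(\<lambda>t. t powr \<kappa>))"
proof -
  let ?g = "\<lambda>t. exp ((Re (H_mu p q a b) - H_Delta p q \<alpha> \<beta> * t) * ln t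
        + (H_Delta p q \<alpha> \<beta> - ln (H_delta p q \<alpha> \<beta>)) * t)"
  obtain \<kappa> where \<kappa>: "\<kappa> < -1" "(\<lambda>t. ?g t * exp (Re logz * t)) \<in> O(\<lambda>t. t powr \<kappa>)"
    using exp_tail_bigo_powr[OF decay] by blast
  show ?thesis
  proof (intro exI conjI allI impI)
    fix \<phi> assume nz: "\<forall>j\<in>{1..m}. Im (b j) + \<beta> j * \<phi> \<noteq> 0"
    \<comment> \<open>The chosen argument of z enters only through a factor constant along the
      ray.\<close>
    have "norm (exp (- Complex (- t) \<phi> * logz)) = exp (\<phi> * Im logz) * exp (Re logz * t)" for t
      by (simp add: algebra_simps flip: exp_add)
    then have "(\<lambda>t. norm (exp (- Complex (- t) \<phi> * logz))) \<in> O(\<lambda>t. exp (Re logz * t))"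
      by simp
    with norm_H_kernel_bigo[OF assms(1-4), where a = a and b = b and \<phi> = \<phi>] nz
    have "(\<lambda>t. norm (H_kernel m n p q a \<alpha> b \<beta> (Complex (- t) \<phi>) * exp (- Complex (- t) \<phi> * logz)))
      \<in> O(\<lambda>t. ?g t * exp (Re logz * t))"
      unfolding norm_mult by (intro landau_o.big.mult) auto
    then show "(\<lambda>t. norm (H_kernel m n p q a \<alpha> b \<beta> (Complex (- t) \<phi>) * exp (- Complex (- t) \<phi> * logz)))
      \<in> O(\<lambda>t. t powr \<kappa>)"
      using \<kappa>(2) by (rule landau_o.big_trans)
  qed (fact \<kappa>)
qed

subsection \<open>Integrals along infinite loops\<close>

text \<open>The derivative of \<open>\<gamma>\<close> may be unbounded near the breakpoints, so the integrand need not be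
  absolutely integrable; its Henstock-Kurzweil integral comes from local primitives of \<open>f\<close>.\<close>

lemma piecewise_C1_holomorphic_integrable:
  fixes \<gamma> :: "real \<Rightarrow> complex"
  assumes \<gamma>: "\<gamma> piecewise_C1_differentiable_on {c..d}" and "c < d"
    and f: "f holomorphic_on S" "open S" and sub: "\<gamma> ` {c..d} \<subseteq> S"
  shows "(\<lambda>t. f (\<gamma> t) * vector_derivative \<gamma> (at t)) integrable_on {c..d}"
proof -
  \<comment> \<open>Rescaling to the unit interval makes the arc a valid path, for which holomorphic
    functions on an open set are contour integrable.\<close>
  define g where "g = \<gamma> \<circ> (\<lambda>u. (d - c) *\<^sub>R u + c)"
  have img: "(\<lambda>u. (d - c) * u + c) ` {0..1} = {c..d}"
    using \<open>c < d\<close> by (simp add: image_affinity_atLeastAtMost)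
  have "valid_path g"
    unfolding valid_path_def g_def
    by (rule piecewise_C1_differentiable_affine) (simp add: img \<gamma>)
  moreover have "path_image g \<subseteq> S"
    using sub unfolding path_image_def g_def image_comp[symmetric] real_scaleR_def img by simp
  ultimately have "f contour_integrable_on g"
    using f by (intro contour_integrable_holomorphic_simple)
  then have "(\<lambda>u. f (g u) * vector_derivative g (at u)) integrable_on cbox 0 1"
    by (simp add: contour_integrable_on)
  from integrable_affinity[OF this, of "1 / (d - c)" "- c / (d - c)"]
  have int: "(\<lambda>t. f (g ((t - c) / (d - c))) * vector_derivative g (at ((t - c) / (d - c)))) integrable_on {c..d}"
    using \<open>c < d\<close> by (simp add: image_affinity_atLeastAtMost diff_divide_distrib)
  obtain A where A: "finite A" "\<And>t. t \<in> {c..d} - A \<Longrightarrow> \<gamma> differentiable at t"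
    using \<gamma> unfolding piecewise_C1_differentiable_on_def C1_differentiable_on_eq by blast
  \<comment> \<open>Back on the original interval the chain rule yields the factor
    \<open>d - c\<close>. It may fail only on the finite set \<open>A\<close>, which does not affect
    integrability.\<close>
  have "(\<lambda>t. of_real (d - c) * (f (\<gamma> t) * vector_derivative \<gamma> (at t))) integrable_on {c..d}"
  proof (rule integrable_spike_finite[OF A(1) _ int])
    fix t assume t: "t \<in> {c..d} - A"
    let ?u = "(t - c) / (d - c)"
    have u: "(d - c) *\<^sub>R ?u + c = t" using \<open>c < d\<close> by simp
    have "(g has_vector_derivative (d - c) *\<^sub>R vector_derivative \<gamma> (at t)) (at ?u)"
      unfolding g_def
    proof (rule vector_diff_chain_at)
      show "((\<lambda>u. (d - c) *\<^sub>R u + c) has_vector_derivative d - c) (at ?u)"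
        by (auto intro!: derivative_eq_intros)
      show "(\<gamma> has_vector_derivative vector_derivative \<gamma> (at t)) (at ((d - c) *\<^sub>R ?u + c))"
        using A(2)[OF t] unfolding u by (simp add: vector_derivative_works)
    qed
    then have "vector_derivative g (at ?u) = (d - c) *\<^sub>R vector_derivative \<gamma> (at t)"
      by (rule vector_derivative_at)
    moreover have "g ?u = \<gamma> t" using u by (simp add: g_def)
    ultimately show "of_real (d - c) * (f (\<gamma> t) * vector_derivative \<gamma> (at t))
        = f (g ?u) * vector_derivative g (at ?u)"
      by (simp add: scaleR_conv_of_real)
  qed
  from integrable_on_cmult_left[OF this, of "inverse (of_real (d - c))"]
  show ?thesis using \<open>c < d\<close> by (simp add: mult.assoc[symmetric])
qed

lemma absolutely_integrable_powr_tail: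
  fixes g :: "real \<Rightarrow> complex"
  assumes cont: "continuous_on {T..} g" and "\<kappa> < -1"
    and bigo: "(\<lambda>t. norm (g t)) \<in> O(\<lambda>t. t powr \<kappa>)"
  shows "g absolutely_integrable_on {T..}"
proof -
  obtain C where "eventually (\<lambda>t. norm (norm (g t)) \<le> C * norm (t powr \<kappa>)) at_top"
    using bigo by (auto elim: landau_o.bigE)
  then obtain X0 where X0: "\<And>t. t \<ge> X0 \<Longrightarrow> norm (g t) \<le> C * (t powr \<kappa>)"
    by (auto simp: eventually_at_top_linorder)
  \<comment> \<open>The 1 keeps the power integrable from X on, \<open>X0\<close> makes the bound
    valid, and \<open>T\<close> lets the two intervals cover the half-line.\<close>
  define X where "X = max 1 (max X0 T)"
  have "g absolutely_integrable_on {T..X}"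
    using cont by (intro absolutely_integrable_continuous_real) (auto elim: continuous_on_subset)
  moreover have "g absolutely_integrable_on {X..}"
  proof (rule measurable_bounded_by_integrable_imp_absolutely_integrable)
    have "continuous_on {X..} g"
      using cont by (rule continuous_on_subset) (auto simp: X_def)
    then show "g \<in> borel_measurable (lebesgue_on {X..})"
      by (intro continuous_imp_measurable_on_sets_lebesgue) auto
    show "(\<lambda>t. C * (t powr \<kappa>)) integrable_on {X..}"
    proof -
      have "X > 0" by (simp add: X_def)
      then have "(\<lambda>t. t powr \<kappa>) integrable_on {X..}"
        using has_integral_powr_to_inf[OF \<open>\<kappa> < -1\<close>] by (auto simp: integrable_on_def)
      from integrable_cmul[OF this, of C] show ?thesis by simp
    qed
    show "norm (g t) \<le> C * (t powr \<kappa>)" if "t \<in> {X..}" for t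
      using that by (intro X0) (auto simp: X_def)
  qed auto
  moreover have "{T..} = {T..X} \<union> {X..}"
    by (auto simp: X_def)
  ultimately show ?thesis
    using absolutely_integrable_Un by metis
qed

text \<open>The line is cut at -T and T. On the outer pieces the derivative of
  \<open>\<gamma>\<close> is the constant -\<sigma> or \<sigma>, so the decay of f suffices; the
  middle piece is a compact arc in S.\<close>

lemma loop_integral_exists:
  assumes loop: "infinite_loop \<sigma> \<phi>1 \<phi>2 \<gamma>" and f: "f holomorphic_on S" "open S"
    and range: "range \<gamma> \<subseteq> S" and "\<kappa> < -1"
    and bigo: "\<And>\<phi>. \<phi> \<in> {\<phi>1, \<phi>2} \<Longrightarrow> (\<lambda>t. norm (f (Complex (\<sigma> * t) \<phi>))) \<in> O(\<lambda>t. t powr \<kappa>)"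
  shows "\<exists>I. has_loop_integral f I \<gamma>"
proof -
  obtain T where "T > 0" and C1: "\<gamma> piecewise_C1_differentiable_on {-T..T}"
    and left: "\<And>t. t \<le> - T \<Longrightarrow> \<gamma> t = Complex (\<sigma> * \<bar>t\<bar>) \<phi>1"
    and right: "\<And>t. t \<ge> T \<Longrightarrow> \<gamma> t = Complex (\<sigma> * \<bar>t\<bar>) \<phi>2"
    using loop by (auto simp: infinite_loop_def)
  let ?F = "\<lambda>t. f (\<gamma> t) * vector_derivative \<gamma> (at t)"
  have ray: "(\<lambda>t. f (Complex (\<sigma> * t) \<phi>)) absolutely_integrable_on {T..}"
    if "\<phi> \<in> {\<phi>1, \<phi>2}" for \<phi>
  proof (rule absolutely_integrable_powr_tail[OF _ \<open>\<kappa> < -1\<close> bigo[OF that]])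
    have "Complex (\<sigma> * t) \<phi> \<in> S" if "t \<ge> T" for t
      using left[of "- t"] right[of t] range \<open>\<phi> \<in> {\<phi>1, \<phi>2}\<close> \<open>T > 0\<close> that
      by (auto simp: image_subset_iff dest: spec[of _ "- t"] spec[of _ t])
    then show "continuous_on {T..} (\<lambda>t. f (Complex (\<sigma> * t) \<phi>))"
      by (intro continuous_on_compose2[OF holomorphic_on_imp_continuous_on[OF f(1)]])
         (auto simp: Complex_eq intro!: continuous_intros)
  qed
  \<comment> \<open>The endpoint is excluded as a spike because the loop may have a corner
    there.\<close>
  have "?F integrable_on {T..}"
  proof (rule integrable_spike_finite[of "{T}"])
    show "(\<lambda>t. f (Complex (\<sigma> * t) \<phi>2) * of_real \<sigma>) integrable_on {T..}"
      using ray[of \<phi>2] by (intro integrable_on_cmult_right set_lebesgue_integral_eq_integral) auto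
    fix t assume t: "t \<in> {T..} - {T}"
    have "((\<lambda>t. Complex (\<sigma> * t) \<phi>2) has_vector_derivative of_real \<sigma>) (at t)"
      unfolding Complex_eq by (auto intro!: derivative_eq_intros)
    then have "(\<gamma> has_vector_derivative of_real \<sigma>) (at t)"
      using t \<open>T > 0\<close> right
      by (elim has_vector_derivative_transform_within_open[of _ _ _ "{T<..}"]) auto
    then show "?F t = f (Complex (\<sigma> * t) \<phi>2) * of_real \<sigma>"
      using t \<open>T > 0\<close> right[of t] by (simp add: vector_derivative_at)
  qed auto
  moreover have "?F integrable_on {..-T}"
  proof (rule integrable_spike_finite[of "{-T}"])
    \<comment> \<open>The reflection of t to -t reduces the incoming half-line to the ray
      estimate.\<close>
    have "(\<lambda>t. f (Complex (- \<sigma> * t) \<phi>1)) absolutely_integrable_on uminus ` {T..}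
        \<longleftrightarrow> (\<lambda>t. \<bar>-1\<bar> *\<^sub>R f (Complex (- \<sigma> * (- t)) \<phi>1)) absolutely_integrable_on {T..}"
      by (rule absolutely_integrable_change_of_variables_real) (auto intro!: derivative_eq_intros)
    then have "(\<lambda>t. f (Complex (- \<sigma> * t) \<phi>1)) absolutely_integrable_on {..-T}"
      using ray[of \<phi>1] by simp
    then show "(\<lambda>t. f (Complex (- \<sigma> * t) \<phi>1) * of_real (- \<sigma>)) integrable_on {..-T}"
      by (intro integrable_on_cmult_right set_lebesgue_integral_eq_integral) auto
    fix t assume t: "t \<in> {..-T} - {-T}"
    have "((\<lambda>t. Complex (- \<sigma> * t) \<phi>1) has_vector_derivative of_real (- \<sigma>)) (at t)"
      unfolding Complex_eq by (auto intro!: derivative_eq_intros)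
    then have "(\<gamma> has_vector_derivative of_real (- \<sigma>)) (at t)"
      using t \<open>T > 0\<close> left
      by (elim has_vector_derivative_transform_within_open[of _ _ _ "{..<-T}"]) auto
    then show "?F t = f (Complex (- \<sigma> * t) \<phi>1) * of_real (- \<sigma>)"
      using t \<open>T > 0\<close> left[of t] by (simp add: vector_derivative_at)
  qed auto
  moreover have "?F integrable_on {-T..T}"
    using C1 \<open>T > 0\<close> f range by (intro piecewise_C1_holomorphic_integrable) auto
  moreover have "{..-T} \<inter> {-T..T} = {-T}" "{..T} \<inter> {T..} = {T}" "{..-T} \<union> {-T..T} = {..T}"
    "{..T} \<union> {T..} = UNIV"
    using \<open>T > 0\<close> by auto
  ultimately have "?F integrable_on UNIV"
    by (metis integrable_Un negligible_sing)
  then show ?thesis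
    unfolding has_loop_integral_def integrable_on_def .
qed

subsection \<open>Existence of the H-function\<close>

text \<open>The region where all numerator Gamma factors are holomorphic; the factors in
  \<open>rGamma\<close> are entire.\<close>

definition H_regular ::
  "nat \<Rightarrow> nat \<Rightarrow> (nat \<Rightarrow> complex) \<Rightarrow> (nat \<Rightarrow> real) \<Rightarrow> (nat \<Rightarrow> complex) \<Rightarrow> (nat \<Rightarrow> real) \<Rightarrow> complex set" where
  "H_regular m n a \<alpha> b \<beta> =
     (\<Inter>j\<in>{1..m}. {s. b j + of_real (\<beta> j) * s \<notin> \<int>\<^sub>\<le>\<^sub>0}) \<inter>
     (\<Inter>i\<in>{1..n}. {s. 1 - a i - of_real (\<alpha> i) * s \<notin> \<int>\<^sub>\<le>\<^sub>0})"

lemma open_H_regular: "open (H_regular m n a \<alpha> b \<beta>)"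
proof -
  have op: "open {s. f s \<notin> \<int>\<^sub>\<le>\<^sub>0}" if "continuous_on UNIV f" for f :: "complex \<Rightarrow> complex"
  proof -
    have "open (f -` (- \<int>\<^sub>\<le>\<^sub>0))"
      using that by (intro open_vimage) auto
    then show ?thesis by (simp add: vimage_def)
  qed
  show ?thesis
    unfolding H_regular_def by (intro open_Int open_INT ballI op continuous_intros) auto
qed

lemma holomorphic_H_kernel: "H_kernel m n p q a \<alpha> b \<beta> holomorphic_on H_regular m n a \<alpha> b \<beta>"
proof -
  have "(\<lambda>s. H_kernel m n p q a \<alpha> b \<beta> s) holomorphic_on H_regular m n a \<alpha> b \<beta>"
    unfolding H_kernel_def by (intro holomorphic_intros) (auto simp: H_regular_def)
  then show ?thesis .
qed

text \<open>Links the contour conditions, phrased by \<open>is_pole\<close>, to the arithmetic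
  conditions in \<open>H_regular\<close>. As r is nonzero, the affine map is injective and carries
  the pole of Gamma over.\<close>

lemma is_pole_Gamma_affine:
  fixes r :: complex
  assumes "r \<noteq> 0" and "c + r * s \<in> \<int>\<^sub>\<le>\<^sub>0"
  shows "is_pole (\<lambda>s. Gamma (c + r * s)) s"
proof (rule is_pole_compose[where g = "\<lambda>s. c + r * s"])
  show "is_pole Gamma (c + r * s)"
    using assms(2) Gamma_poles by (auto simp: is_pole_def elim!: nonpos_Ints_cases')
  show "(\<lambda>s. c + r * s) \<midarrow>s\<rightarrow> c + r * s"
    by (intro tendsto_intros)
  show "eventually (\<lambda>w. c + r * w \<noteq> c + r * s) (at s)"
    using assms(1) by (auto simp: eventually_at_filter)
qed

section \<open>Position of the loop relative to the poles\<close>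

lemma loop_inside_disjoint_range:
  assumes "\<phi>1 < \<phi>2" and "\<bar>\<sigma>\<bar> = 1"
  shows "loop_inside \<sigma> \<phi>1 \<phi>2 \<gamma> \<inter> range \<gamma> = {}"
proof -
  have "s \<notin> range \<gamma>" if s: "s \<in> loop_inside \<sigma> \<phi>1 \<phi>2 \<gamma>" for s
  proof -
    obtain R where R: "\<forall>w. \<phi>1 < Im w \<and> Im w < \<phi>2 \<and> \<sigma> * Re w \<ge> R \<longrightarrow>
        connected_component (- range \<gamma>) s w"
      using s unfolding loop_inside_def by auto
    \<comment> \<open>A point on the midline of the strip with real part \<open>\<sigma> * R\<close>
      witnesses that s lies in a component of the complement.\<close>
    have "\<sigma> * \<sigma> = 1" using assms(2) by (metis abs_mult_self_eq mult_1)
    then have "connected_component (- range \<gamma>) s (Complex (\<sigma> * R) ((\<phi>1 + \<phi>2) / 2))"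
      using assms(1) by (intro R[rule_format]) (auto simp: mult.assoc[symmetric])
    then show ?thesis using connected_component_in by blast
  qed
  then show ?thesis by auto
qed

text \<open>A and B are left abstract because inside and outside change places between the two
  directions of the loop.\<close>

lemma range_subset_H_regular:
  assumes disj: "\<And>s. s \<in> A \<union> B \<Longrightarrow> s \<notin> range \<gamma>"
    and "\<And>j. j \<in> {1..m} \<Longrightarrow> \<beta> j > 0" and "\<And>i. i \<in> {1..n} \<Longrightarrow> \<alpha> i > 0"
    and "\<forall>j\<in>{1..m}. \<forall>s. is_pole (\<lambda>s. Gamma (b j + of_real (\<beta> j) * s)) s \<longrightarrow> s \<in> A"
    and "\<forall>i\<in>{1..n}. \<forall>s. is_pole (\<lambda>s. Gamma (1 - a i - of_real (\<alpha> i) * s)) s \<longrightarrow> s \<in> B"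
  shows "range \<gamma> \<subseteq> H_regular m n a \<alpha> b \<beta>"
proof
  fix s assume s: "s \<in> range \<gamma>"
  have "b j + of_real (\<beta> j) * s \<notin> \<int>\<^sub>\<le>\<^sub>0" if "j \<in> {1..m}" for j
    using is_pole_Gamma_affine[of "of_real (\<beta> j)" "b j" s] assms(2,4) that s disj[of s]
    by (metis UnI1 less_irrefl of_real_eq_0_iff)
  moreover have "1 - a i - of_real (\<alpha> i) * s \<notin> \<int>\<^sub>\<le>\<^sub>0" if "i \<in> {1..n}" for i
  proof
    assume "1 - a i - of_real (\<alpha> i) * s \<in> \<int>\<^sub>\<le>\<^sub>0"
    then have "is_pole (\<lambda>s. Gamma (1 - a i - of_real (\<alpha> i) * s)) s"
      using is_pole_Gamma_affine[of "- of_real (\<alpha> i)" "1 - a i" s] assms(3)[OF that] by auto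
    then show False using assms(5) that s disj[of s] by blast
  qed
  ultimately show "s \<in> H_regular m n a \<alpha> b \<beta>" by (auto simp: H_regular_def)
qed

text \<open>If the pole sequence \<open>c + r s = -k\<close> were on the line of a half-line of the loop, its far
  members would lie on the loop.\<close>

lemma infinite_loop_avoids_pole_line:
  assumes loop: "infinite_loop \<sigma> \<phi>1 \<phi>2 \<gamma>" and "\<phi> \<in> {\<phi>1, \<phi>2}" and "\<sigma> * r < 0"
    and avoid: "\<And>s. s \<in> range \<gamma> \<Longrightarrow> c + of_real r * s \<notin> \<int>\<^sub>\<le>\<^sub>0"
  shows "Im c + r * \<phi> \<noteq> 0"
proof
  assume im: "Im c + r * \<phi> = 0"
  obtain T where "T > 0"
    and left: "\<And>t. t \<le> - T \<Longrightarrow> \<gamma> t = Complex (\<sigma> * \<bar>t\<bar>) \<phi>1"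
    and right: "\<And>t. t \<ge> T \<Longrightarrow> \<gamma> t = Complex (\<sigma> * \<bar>t\<bar>) \<phi>2"
    using loop by (auto simp: infinite_loop_def)
  \<comment> \<open>Since \<open>- \<sigma> * r > 0\<close>, a large k places the pole with value -k
    at parameter \<open>t \<ge> T\<close>, hence on a half-line of the loop.\<close>
  obtain k :: nat where k: "T * (- \<sigma> * r) - Re c \<le> real k"
    using real_arch_simple by blast
  define t where "t = (real k + Re c) / (- \<sigma> * r)"
  have "t \<ge> T" using k assms(3) by (simp add: t_def field_simps)
  then have "Complex (\<sigma> * t) \<phi> \<in> range \<gamma>"
    using left[of "- t"] right[of t] assms(2) \<open>T > 0\<close> by (auto intro: range_eqI[of _ _ "- t"] range_eqI[of _ _ t])
  moreover have "r * (\<sigma> * t) = - (real k + Re c)"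
  proof -
    have "\<sigma> \<noteq> 0" "r \<noteq> 0" using assms(3) by auto
    then show ?thesis by (simp add: t_def field_simps)
  qed
  then have "c + of_real r * Complex (\<sigma> * t) \<phi> = - of_nat k"
    using im by (simp add: complex_eq_iff)
  ultimately show False using avoid by force
qed

lemma has_H_function_exists:
  assumes "infinite_loop \<sigma> \<phi>1 \<phi>2 \<gamma>" and "range \<gamma> \<subseteq> H_regular m n a \<alpha> b \<beta>" and "\<kappa> < -1"
    and "\<And>\<phi>. \<phi> \<in> {\<phi>1, \<phi>2} \<Longrightarrow>
      (\<lambda>t. norm (H_kernel m n p q a \<alpha> b \<beta> (Complex (\<sigma> * t) \<phi>) * exp (- Complex (\<sigma> * t) \<phi> * logz)))
        \<in> O(\<lambda>t. t powr \<kappa>)"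
  shows "\<exists>h. has_H_function m n p q a \<alpha> b \<beta> \<gamma> logz h"
proof -
  have "(\<lambda>s. H_kernel m n p q a \<alpha> b \<beta> s * exp (- s * logz)) holomorphic_on H_regular m n a \<alpha> b \<beta>"
    by (intro holomorphic_intros holomorphic_H_kernel)
  from loop_integral_exists[OF assms(1) this open_H_regular assms(2,3)] assms(4)
  show ?thesis unfolding has_H_function_def by blast
qed

section \<open>The two directions of the loop\<close>

lemma has_H_function_minus_infinity:
  assumes mn: "m \<le> q" "n \<le> p"
    and \<alpha>: "\<And>i. i \<in> {1..p} \<Longrightarrow> \<alpha> i > 0" and \<beta>: "\<And>j. j \<in> {1..q} \<Longrightarrow> \<beta> j > 0"
    and loop: "H_loop_minus_infinity m n a \<alpha> b \<beta> \<gamma>"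
    and decay: "H_Delta p q \<alpha> \<beta> > 0 \<or>
      H_Delta p q \<alpha> \<beta> = 0 \<and> Re logz < ln (H_delta p q \<alpha> \<beta>) \<or>
      H_Delta p q \<alpha> \<beta> = 0 \<and> Re logz = ln (H_delta p q \<alpha> \<beta>) \<and> Re (H_mu p q a b) < -1"
  shows "\<exists>h. has_H_function m n p q a \<alpha> b \<beta> \<gamma> logz h"
proof -
  obtain \<phi>1 \<phi>2 where il: "infinite_loop (-1) \<phi>1 \<phi>2 \<gamma>"
    and poles: "\<forall>j\<in>{1..m}. \<forall>s. is_pole (\<lambda>s. Gamma (b j + of_real (\<beta> j) * s)) s
        \<longrightarrow> s \<in> loop_inside (-1) \<phi>1 \<phi>2 \<gamma>"
      "\<forall>i\<in>{1..n}. \<forall>s. is_pole (\<lambda>s. Gamma (1 - a i - of_real (\<alpha> i) * s)) s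
        \<longrightarrow> s \<in> loop_outside (-1) \<phi>1 \<phi>2 \<gamma>"
    using loop unfolding H_loop_minus_infinity_def by blast
  have "loop_inside (-1) \<phi>1 \<phi>2 \<gamma> \<inter> range \<gamma> = {}"
    using il by (intro loop_inside_disjoint_range) (auto simp: infinite_loop_def)
  then have reg: "range \<gamma> \<subseteq> H_regular m n a \<alpha> b \<beta>"
    using mn by (intro range_subset_H_regular[OF _ _ _ poles]) (auto simp: loop_outside_def intro: \<alpha> \<beta>)
  obtain \<kappa> where \<kappa>: "\<kappa> < -1" "\<And>\<phi>. (\<forall>j\<in>{1..m}. Im (b j) + \<beta> j * \<phi> \<noteq> 0) \<Longrightarrow>
    (\<lambda>t. norm (H_kernel m n p q a \<alpha> b \<beta> (Complex (- t) \<phi>) * exp (- Complex (- t) \<phi> * logz)))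
      \<in> O(\<lambda>t. t powr \<kappa>)"
    using H_integrand_bigo_powr[OF mn \<alpha> \<beta> decay] by blast
  show ?thesis
  proof (rule has_H_function_exists[OF il reg \<kappa>(1)])
    fix \<phi> assume "\<phi> \<in> {\<phi>1, \<phi>2}"
    then have "Im (b j) + \<beta> j * \<phi> \<noteq> 0" if "j \<in> {1..m}" for j
      using that reg mn by (intro infinite_loop_avoids_pole_line[OF il]) (auto simp: H_regular_def intro!: \<beta>)
    then show "(\<lambda>t. norm (H_kernel m n p q a \<alpha> b \<beta> (Complex (- 1 * t) \<phi>) * exp (- Complex (- 1 * t) \<phi> * logz)))
        \<in> O(\<lambda>t. t powr \<kappa>)"
      using \<kappa>(2)[of \<phi>] by simp
  qed
qed

text \<open>After the swap \<Delta> changes sign, \<delta> becomes its reciprocal and log z becomes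
  -log z, so the decay conditions turn into those for loops to the left.\<close>

lemma has_H_function_plus_infinity:
  assumes mn: "m \<le> q" "n \<le> p"
    and \<alpha>: "\<And>i. i \<in> {1..p} \<Longrightarrow> \<alpha> i > 0" and \<beta>: "\<And>j. j \<in> {1..q} \<Longrightarrow> \<beta> j > 0"
    and loop: "H_loop_plus_infinity m n a \<alpha> b \<beta> \<gamma>"
    and decay: "H_Delta p q \<alpha> \<beta> < 0 \<or>
      H_Delta p q \<alpha> \<beta> = 0 \<and> Re logz > ln (H_delta p q \<alpha> \<beta>) \<or>
      H_Delta p q \<alpha> \<beta> = 0 \<and> Re logz = ln (H_delta p q \<alpha> \<beta>) \<and> Re (H_mu p q a b) < -1"
  shows "\<exists>h. has_H_function m n p q a \<alpha> b \<beta> \<gamma> logz h"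
proof -
  obtain \<phi>1 \<phi>2 where il: "infinite_loop 1 \<phi>1 \<phi>2 \<gamma>"
    and poles: "\<forall>j\<in>{1..m}. \<forall>s. is_pole (\<lambda>s. Gamma (b j + of_real (\<beta> j) * s)) s
        \<longrightarrow> s \<in> loop_outside 1 \<phi>1 \<phi>2 \<gamma>"
      "\<forall>i\<in>{1..n}. \<forall>s. is_pole (\<lambda>s. Gamma (1 - a i - of_real (\<alpha> i) * s)) s
        \<longrightarrow> s \<in> loop_inside 1 \<phi>1 \<phi>2 \<gamma>"
    using loop unfolding H_loop_plus_infinity_def by blast
  have "loop_inside 1 \<phi>1 \<phi>2 \<gamma> \<inter> range \<gamma> = {}"
    using il by (intro loop_inside_disjoint_range) (auto simp: infinite_loop_def)
  then have reg: "range \<gamma> \<subseteq> H_regular m n a \<alpha> b \<beta>"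
    using mn by (intro range_subset_H_regular[OF _ _ _ poles]) (auto simp: loop_outside_def intro: \<alpha> \<beta>)
  have "ln (H_delta q p \<beta> \<alpha>) = - ln (H_delta p q \<alpha> \<beta>)"
    using ln_H_delta[of p \<alpha> q \<beta>] ln_H_delta[of q \<beta> p \<alpha>] \<alpha> \<beta> by simp
  then have decay': "H_Delta q p \<beta> \<alpha> > 0 \<or>
      H_Delta q p \<beta> \<alpha> = 0 \<and> Re (- logz) < ln (H_delta q p \<beta> \<alpha>) \<or>
      H_Delta q p \<beta> \<alpha> = 0 \<and> Re (- logz) = ln (H_delta q p \<beta> \<alpha>) \<and>
        Re (H_mu q p (\<lambda>j. 1 - b j) (\<lambda>i. 1 - a i)) < -1"
    using decay unfolding H_mu_swap H_Delta_swap[of q p] by auto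
  obtain \<kappa> where \<kappa>: "\<kappa> < -1" "\<And>\<phi>. (\<forall>i\<in>{1..n}. Im (1 - a i) + \<alpha> i * \<phi> \<noteq> 0) \<Longrightarrow>
    (\<lambda>t. norm (H_kernel n m q p (\<lambda>j. 1 - b j) \<beta> (\<lambda>i. 1 - a i) \<alpha> (Complex (- t) \<phi>)
        * exp (- Complex (- t) \<phi> * (- logz)))) \<in> O(\<lambda>t. t powr \<kappa>)"
    using H_integrand_bigo_powr[OF mn(2,1) \<beta> \<alpha> decay'] by blast
  show ?thesis
  proof (rule has_H_function_exists[OF il reg \<kappa>(1)])
    fix \<phi> assume \<phi>: "\<phi> \<in> {\<phi>1, \<phi>2}"
    \<comment> \<open>For a loop to the right the slope must be negative, so the pole-line lemma is
      used with \<open>r = - \<alpha> i\<close>; the height becomes -\<phi> after the swap.\<close>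
    have "Im (1 - a i) + (- \<alpha> i) * \<phi> \<noteq> 0" if "i \<in> {1..n}" for i
      using that reg mn \<phi> by (intro infinite_loop_avoids_pole_line[OF il]) (auto simp: H_regular_def intro!: \<alpha>)
    then have nz: "\<forall>i\<in>{1..n}. Im (1 - a i) + \<alpha> i * (- \<phi>) \<noteq> 0" by simp
    have "Complex (- t) (- \<phi>) = - Complex t \<phi>" for t by (simp add: complex_eq_iff)
    then show "(\<lambda>t. norm (H_kernel m n p q a \<alpha> b \<beta> (Complex (1 * t) \<phi>) * exp (- Complex (1 * t) \<phi> * logz)))
        \<in> O(\<lambda>t. t powr \<kappa>)"
      using \<kappa>(2)[OF nz] by (simp add: H_kernel_swap[of m n p q a])
  qed
qed

theorem theorem1:
  fixes m n p q :: nat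
    and a b :: "nat \<Rightarrow> complex" and \<alpha> \<beta> :: "nat \<Rightarrow> real"
    and z logz :: complex and \<gamma> :: "real \<Rightarrow> complex"
  assumes "m \<le> q" and "n \<le> p"
    and "\<And>i. i \<in> {1..p} \<Longrightarrow> \<alpha> i > 0"
    and "\<And>j. j \<in> {1..q} \<Longrightarrow> \<beta> j > 0"
    and "exp logz = z"
    and "(H_loop_minus_infinity m n a \<alpha> b \<beta> \<gamma> \<and> H_Delta p q \<alpha> \<beta> > 0 \<and> z \<noteq> 0) \<or>
         (H_loop_minus_infinity m n a \<alpha> b \<beta> \<gamma> \<and> H_Delta p q \<alpha> \<beta> = 0 \<and>
            0 < cmod z \<and> cmod z < H_delta p q \<alpha> \<beta>) \<or>
         (H_loop_minus_infinity m n a \<alpha> b \<beta> \<gamma> \<and> H_Delta p q \<alpha> \<beta> = 0 \<and>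
            cmod z = H_delta p q \<alpha> \<beta> \<and> Re (H_mu p q a b) < -1) \<or>
         (H_loop_plus_infinity m n a \<alpha> b \<beta> \<gamma> \<and> H_Delta p q \<alpha> \<beta> < 0 \<and> z \<noteq> 0) \<or>
         (H_loop_plus_infinity m n a \<alpha> b \<beta> \<gamma> \<and> H_Delta p q \<alpha> \<beta> = 0 \<and>
            cmod z > H_delta p q \<alpha> \<beta>) \<or>
         (H_loop_plus_infinity m n a \<alpha> b \<beta> \<gamma> \<and> H_Delta p q \<alpha> \<beta> = 0 \<and>
            cmod z = H_delta p q \<alpha> \<beta> \<and> Re (H_mu p q a b) < -1)"
  shows "\<exists>h. has_H_function m n p q a \<alpha> b \<beta> \<gamma> logz h"
proof -
  have pos: "H_delta p q \<alpha> \<beta> > 0"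
    using assms(3,4) by (rule H_delta_pos)
  \<comment> \<open>Any logarithm of z has real part \<open>ln (cmod z)\<close>; by monotonicity the
    conditions on \<open>cmod z\<close> become the logarithmic ones.\<close>
  have "z \<noteq> 0" "Re logz = ln (cmod z)"
    using assms(5) by auto
  then have "Re logz < ln (H_delta p q \<alpha> \<beta>) \<longleftrightarrow> cmod z < H_delta p q \<alpha> \<beta>"
    "Re logz > ln (H_delta p q \<alpha> \<beta>) \<longleftrightarrow> cmod z > H_delta p q \<alpha> \<beta>"
    "Re logz = ln (H_delta p q \<alpha> \<beta>) \<longleftrightarrow> cmod z = H_delta p q \<alpha> \<beta>"
    using pos by simp_all
  then show ?thesis
    using assms(6) has_H_function_minus_infinity[of m q n p \<alpha> \<beta> a b \<gamma> logz, OF assms(1-4)]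
      has_H_function_plus_infinity[of m q n p \<alpha> \<beta> a b \<gamma> logz, OF assms(1-4)]
    by blast
qed

end
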